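(* Let $\gamma,\Gamma\in\mathbb{C}$ with $\operatorname{Re}(\Gamma\bar\gamma)>0$, and let $z_1,\dots,z_n\in\mathbb{C}$ be such that $$(\operatorname{Re}\Gamma-\operatorname{Re}z_j)(\operatorname{Re}z_j-\operatorname{Re}\gamma)+(\operatorname{Im}\Gamma-\operatorname{Im}z_j)(\operatorname{Im}z_j-\operatorname{Im}\gamma)\geq 0$$ or, equivalently, $$\left|z_j-\frac{\gamma+\Gamma}{2}\right|\leq\frac12|\Gamma-\gamma|$$ for each $j\in\{1,\dots,n\}$. Then $$\sum_{j=1}^{n}|z_j|^2\leq\frac1n\cdot\frac{|\Gamma+\gamma|^2}{4\operatorname{Re}(\Gamma\bar\gamma)}\left|\sum_{j=1}^{n}z_j\right|^2.$$ Equality holds in this last inequality if and only if $$\left|z_j-\frac{\gamma+\Gamma}{2}\right|=\frac12|\Gamma-\gamma|\quad\text{for each } j\in\{1,\dots,n\}$$ and $$\frac1n\sum_{j=1}^{n}z_j=\frac{2\operatorname{Re}(\Gamma\bar\gamma)}{\overline{\Gamma}+\overline{\gamma}}.$$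
   Context: $n\geq 1$ is an integer; $\operatorname{Re}$, $\operatorname{Im}$ and the bar denote real part, imaginary part and complex conjugation. *)

theory Defs
  imports Complex_Main
begin

end

theory Submission
  imports Defs
begin

text \<open>
  Write \<open>s = \<Gamma> + \<gamma>\<close>, \<open>r = Re (\<Gamma> * cnj \<gamma>)\<close> and \<open>S = \<Sum>j=1..n. z j\<close>, and let \<open>d j\<close> be the left-hand side
  of the hypothesis on \<open>z j\<close>. Two identities for \<open>d j\<close> carry the proof. On the one hand, \<open>d j\<close> is
  the difference of the squares of the radius \<open>cmod (\<Gamma> - \<gamma>) / 2\<close> and of the distance from \<open>z j\<close> to
  the centre \<open>s / 2\<close>, so its sign decides whether \<open>z j\<close> lies in the disc with diameter from
  \<open>\<gamma>\<close> to \<open>\<Gamma>\<close>, and it vanishes exactly on the bounding circle. On the other hand,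
  \<open>d j = Re (cnj s * z j) - (cmod (z j))\<^sup>2 - r\<close>, which can be summed over \<open>j\<close>.

  The sum of the \<open>(cmod (z j))\<^sup>2\<close> is therefore \<open>Re (cnj s * S) - n * r\<close> minus the sum of the \<open>d j\<close>,
  and completing the square (lemma \<open>complete_square\<close>) compares the first part with the bound.
  The right-hand side of the inequality exceeds the left-hand side by exactly
  \[ \sum_j d_j + \frac{|\bar s S - 2 n r|^2}{4 n r}, \]
  as stated in lemma \<open>reverse_quadratic_gap\<close>. All terms are nonnegative, and equality means that
  each of them vanishes: every \<open>z j\<close> is on the circle and the mean is \<open>2 * r / cnj s\<close>.
\<close>

definition disc_slack :: "complex \<Rightarrow> complex \<Rightarrow> complex \<Rightarrow> real" where
  "disc_slack \<gamma> \<Gamma> z =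
     (Re \<Gamma> - Re z) * (Re z - Re \<gamma>) + (Im \<Gamma> - Im z) * (Im z - Im \<gamma>)"

lemma disc_slack_eq_radius_minus_distance:
  "disc_slack \<gamma> \<Gamma> z = (1 / 2 * cmod (\<Gamma> - \<gamma>))\<^sup>2 - (cmod (z - (\<gamma> + \<Gamma>) / 2))\<^sup>2"
  unfolding disc_slack_def power_mult_distrib cmod_power2
  by (simp add: field_simps power2_eq_square)

lemma disc_slack_nonneg_iff:
  "disc_slack \<gamma> \<Gamma> z \<ge> 0 \<longleftrightarrow> cmod (z - (\<gamma> + \<Gamma>) / 2) \<le> 1 / 2 * cmod (\<Gamma> - \<gamma>)"
  unfolding disc_slack_eq_radius_minus_distance diff_ge_0_iff_ge
  by (rule power_mono_iff) auto

lemma disc_slack_eq_0_iff: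
  "disc_slack \<gamma> \<Gamma> z = 0 \<longleftrightarrow> cmod (z - (\<gamma> + \<Gamma>) / 2) = 1 / 2 * cmod (\<Gamma> - \<gamma>)"
proof -
  have "disc_slack \<gamma> \<Gamma> z = 0 \<longleftrightarrow>
      (1 / 2 * cmod (\<Gamma> - \<gamma>))\<^sup>2 = (cmod (z - (\<gamma> + \<Gamma>) / 2))\<^sup>2"
    unfolding disc_slack_eq_radius_minus_distance by simp
  also have "\<dots> \<longleftrightarrow> 1 / 2 * cmod (\<Gamma> - \<gamma>) = cmod (z - (\<gamma> + \<Gamma>) / 2)"
    by (rule power2_eq_iff_nonneg) auto
  finally show ?thesis
    by auto
qed

lemma norm_sq_eq_linear_minus_slack:
  "(cmod z)\<^sup>2 = Re (cnj (\<Gamma> + \<gamma>) * z) - Re (\<Gamma> * cnj \<gamma>) - disc_slack \<gamma> \<Gamma> z"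
  unfolding disc_slack_def cmod_power2
  by (simp add: algebra_simps power2_eq_square)

lemma complete_square:
  fixes s w :: complex and c r :: real
  assumes "c > 0" and "r > 0"
  shows "1 / c * ((cmod s)\<^sup>2 / (4 * r)) * (cmod w)\<^sup>2
       = Re (cnj s * w) - c * r + (cmod (cnj s * w - complex_of_real (2 * c * r)))\<^sup>2 / (4 * c * r)"
proof -
  have "(cmod (cnj s * w - complex_of_real (2 * c * r)))\<^sup>2
      = (cmod (cnj s * w))\<^sup>2 - 4 * c * r * Re (cnj s * w) + (2 * c * r)\<^sup>2"
    unfolding cmod_power2 by (simp add: power2_eq_square algebra_simps)
  then have "(cmod (cnj s * w - complex_of_real (2 * c * r)))\<^sup>2
      = (cmod s)\<^sup>2 * (cmod w)\<^sup>2 - 4 * c * r * Re (cnj s * w) + (2 * c * r)\<^sup>2"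
    by (simp add: norm_mult power_mult_distrib)
  then show ?thesis
    using assms by (simp add: field_simps power2_eq_square)
qed

lemma reverse_quadratic_gap:
  fixes \<gamma> \<Gamma> :: complex and n :: nat and z :: "nat \<Rightarrow> complex"
  assumes "n \<ge> 1" and "Re (\<Gamma> * cnj \<gamma>) > 0"
  shows "1 / real n * ((cmod (\<Gamma> + \<gamma>))\<^sup>2 / (4 * Re (\<Gamma> * cnj \<gamma>))) * (cmod (\<Sum>j=1..n. z j))\<^sup>2
       = (\<Sum>j=1..n. (cmod (z j))\<^sup>2) + (\<Sum>j=1..n. disc_slack \<gamma> \<Gamma> (z j))
         + (cmod (cnj (\<Gamma> + \<gamma>) * (\<Sum>j=1..n. z j)
              - complex_of_real (2 * real n * Re (\<Gamma> * cnj \<gamma>))))\<^sup>2 / (4 * real n * Re (\<Gamma> * cnj \<gamma>))"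
proof -
  have "(\<Sum>j=1..n. (cmod (z j))\<^sup>2)
      = (\<Sum>j=1..n. Re (cnj (\<Gamma> + \<gamma>) * z j) - Re (\<Gamma> * cnj \<gamma>) - disc_slack \<gamma> \<Gamma> (z j))"
    by (rule sum.cong[OF refl norm_sq_eq_linear_minus_slack])
  also have "\<dots> = Re (cnj (\<Gamma> + \<gamma>) * (\<Sum>j=1..n. z j)) - real n * Re (\<Gamma> * cnj \<gamma>)
      - (\<Sum>j=1..n. disc_slack \<gamma> \<Gamma> (z j))"
    unfolding sum_subtractf sum_distrib_left Re_sum by simp
  finally show ?thesis
    using complete_square[of "real n" "Re (\<Gamma> * cnj \<gamma>)" "\<Gamma> + \<gamma>" "\<Sum>j=1..n. z j"] assms
    by linarith
qed

text \<open>
  This lets the condition on the mean be cleared of denominators: \<open>\<Gamma> = - \<gamma>\<close> would make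
  \<open>Re (\<Gamma> * cnj \<gamma>)\<close> equal to \<open>- (cmod \<gamma>)\<^sup>2\<close>.
\<close>
lemma sum_nonzero_if_Re_mult_cnj_pos:
  assumes "Re (\<Gamma> * cnj \<gamma>) > 0"
  shows "\<Gamma> + \<gamma> \<noteq> 0"
proof
  assume "\<Gamma> + \<gamma> = 0"
  then have "\<Gamma> = - \<gamma>"
    by (simp add: eq_neg_iff_add_eq_0)
  then have "Re (\<Gamma> * cnj \<gamma>) = - ((Re \<gamma>)\<^sup>2 + (Im \<gamma>)\<^sup>2)"
    by (simp add: power2_eq_square)
  with assms show False
    by (smt (verit) zero_le_power2)
qed

theorem mainTheorem4:
  fixes \<gamma> \<Gamma> :: complex and n :: nat and z :: "nat \<Rightarrow> complex"
  assumes "n \<ge> 1"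
    and "Re (\<Gamma> * cnj \<gamma>) > 0"
  shows "(\<forall>j\<in>{1..n}.
            (Re \<Gamma> - Re (z j)) * (Re (z j) - Re \<gamma>) + (Im \<Gamma> - Im (z j)) * (Im (z j) - Im \<gamma>) \<ge> 0
              \<longleftrightarrow> cmod (z j - (\<gamma> + \<Gamma>) / 2) \<le> 1 / 2 * cmod (\<Gamma> - \<gamma>))
       \<and> ((\<forall>j\<in>{1..n}.
            (Re \<Gamma> - Re (z j)) * (Re (z j) - Re \<gamma>) + (Im \<Gamma> - Im (z j)) * (Im (z j) - Im \<gamma>) \<ge> 0)
          \<longrightarrow>
            (\<Sum>j=1..n. (cmod (z j))\<^sup>2)
              \<le> 1 / real n * ((cmod (\<Gamma> + \<gamma>))\<^sup>2 / (4 * Re (\<Gamma> * cnj \<gamma>))) * (cmod (\<Sum>j=1..n. z j))\<^sup>2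
          \<and> ((\<Sum>j=1..n. (cmod (z j))\<^sup>2)
                = 1 / real n * ((cmod (\<Gamma> + \<gamma>))\<^sup>2 / (4 * Re (\<Gamma> * cnj \<gamma>))) * (cmod (\<Sum>j=1..n. z j))\<^sup>2
              \<longleftrightarrow> (\<forall>j\<in>{1..n}. cmod (z j - (\<gamma> + \<Gamma>) / 2) = 1 / 2 * cmod (\<Gamma> - \<gamma>))
                \<and> 1 / of_nat n * (\<Sum>j=1..n. z j)
                    = complex_of_real (2 * Re (\<Gamma> * cnj \<gamma>)) / (cnj \<Gamma> + cnj \<gamma>)))"
proof -
  let ?r = "Re (\<Gamma> * cnj \<gamma>)"
  let ?S = "\<Sum>j=1..n. z j"
  let ?B = "1 / real n * ((cmod (\<Gamma> + \<gamma>))\<^sup>2 / (4 * ?r)) * (cmod ?S)\<^sup>2"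
  let ?v = "cnj (\<Gamma> + \<gamma>) * ?S - complex_of_real (2 * real n * ?r)"
  let ?D = "\<Sum>j=1..n. disc_slack \<gamma> \<Gamma> (z j)"
  let ?Q = "(cmod ?v)\<^sup>2 / (4 * real n * ?r)"
  have n: "real n > 0" and nr: "4 * real n * ?r > 0"
    using assms by (auto intro: mult_pos_pos)
  have gap: "?B = (\<Sum>j=1..n. (cmod (z j))\<^sup>2) + ?D + ?Q"
    by (rule reverse_quadratic_gap[OF assms])
  have Q_nonneg: "?Q \<ge> 0"
    using nr by (intro divide_nonneg_pos) auto
  have "cnj \<Gamma> + cnj \<gamma> \<noteq> 0"
    using sum_nonzero_if_Re_mult_cnj_pos[OF assms(2)]
    by (metis complex_cnj_add complex_cnj_zero_iff)
  then have mean: "1 / of_nat n * ?S = complex_of_real (2 * ?r) / (cnj \<Gamma> + cnj \<gamma>)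
      \<longleftrightarrow> ?v = 0"
    using n by (simp add: field_simps del: times_complex.sel)
  have Q_zero: "?Q = 0 \<longleftrightarrow> ?v = 0"
    using nr by (simp only: divide_eq_0_iff zero_eq_power2 norm_eq_zero) linarith
  have "(\<Sum>j=1..n. (cmod (z j))\<^sup>2) \<le> ?B
      \<and> ((\<Sum>j=1..n. (cmod (z j))\<^sup>2) = ?B
          \<longleftrightarrow> (\<forall>j\<in>{1..n}. disc_slack \<gamma> \<Gamma> (z j) = 0) \<and> ?v = 0)"
    if nonneg: "\<forall>j\<in>{1..n}. disc_slack \<gamma> \<Gamma> (z j) \<ge> 0"
  proof -
    have D_nonneg: "?D \<ge> 0"
      using nonneg by (intro sum_nonneg) auto
    have D_zero: "?D = 0 \<longleftrightarrow> (\<forall>j\<in>{1..n}. disc_slack \<gamma> \<Gamma> (z j) = 0)"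
      using nonneg by (intro sum_nonneg_eq_0_iff) auto
    have "(\<Sum>j=1..n. (cmod (z j))\<^sup>2) = ?B \<longleftrightarrow> ?D = 0 \<and> ?Q = 0"
      using gap D_nonneg Q_nonneg by linarith
    moreover have "(\<Sum>j=1..n. (cmod (z j))\<^sup>2) \<le> ?B"
      using gap D_nonneg Q_nonneg by linarith
    ultimately show ?thesis
      unfolding D_zero Q_zero by blast
  qed
  then show ?thesis
    unfolding mean disc_slack_def[symmetric] disc_slack_nonneg_iff disc_slack_eq_0_iff
    by blast
qed

end
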